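(* Let the labor flow networks of two economies be represented by adjacency matrices $\mathbf{A}$ and $\mathbf{A}'$, with corresponding degree distributions $P$ and $P'$, and aggregate unemployment rates $u=\sum_{k=1}^{k_{\max}} u_k P(k)$ and $u'=\sum_{k=1}^{k_{\max}} u_k P'(k)$, where $$u_k=\frac{\lambda}{\lambda +h^*[1-(1-v)^{k}]}$$ is the firm-specific unemployment rate of a firm of degree $k$. If $P'$ is a strict mean-preserving spread of $P$, then $u<u'$.
   Context: A labor flow network is an undirected, unweighted graph without self-loops and with a single connected component, whose nodes are firms; the degree of a firm is its number of edges, and the degree distribution $P$ assigns to each $k\in\{1,\dots,k_{\max}\}$ the fraction $P(k)$ of firms with degree $k$, where $k_{\max}$ bounds the degrees in both networks. The two economies share the following parameters: $\lambda$, the probability that an employed worker becomes separated from his or her firm in a period; $v$, the probability that a firm receives an investment and can open vacancies in a period; productivity $y$; a single exogenous wage $w$; and cost parameters $c\in(0,1)$ and $\kappa\in[0,1]$. All firms set the same optimal hiring policy (the probability that an applicant is hired) $h^*=\frac{\psi}{2\phi}(y-w)$, where $\psi=1-\lambda+v\lambda$ and $\phi=c(v+\kappa-v\kappa)$; it does not depend on the degree of the firm. $P'$ is a strict mean-preserving spread of $P$ if $P$ and $P'$ have the same mean and $\sum_{m\le k}\sum_{j\le m}P(j)\le\sum_{m\le k}\sum_{j\le m}P'(j)$ for all $k$, with strict inequality for at least one $k$.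
   Formalization: The formal statement assumes 0 < λ ≤ 1, 0 < v < 1 and w < y (so h* > 0); at λ = 0, v = 0, v = 1 or w = y the rate u_k is constant in k ≥ 1 (or undefined), so u = u' and the strict inequality fails. *)

theory Defs
  imports "HOL-Analysis.Analysis"
begin

definition labor_flow_network :: "real^'n^'n \<Rightarrow> bool" where
  "labor_flow_network A \<longleftrightarrow>
     (\<forall>i j. A $ i $ j \<in> {0, 1}) \<and>
     transpose A = A \<and>
     (\<forall>i. A $ i $ i = 0) \<and>
     (\<forall>i j. (\<lambda>a b. A $ a $ b = 1)\<^sup>*\<^sup>* i j)"

definition firm_degree :: "real^'n^'n \<Rightarrow> 'n \<Rightarrow> nat" where
  "firm_degree A i = card {j. A $ i $ j = 1}"

definition degree_distribution :: "real^'n^'n \<Rightarrow> nat \<Rightarrow> real" where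
  "degree_distribution A k = real (card {i. firm_degree A i = k}) / real CARD('n)"

(* The first distribution is the spread of the second.  Sums start at degree 1, since every firm
   in a connected network with more than one firm has at least one edge. *)
definition strict_mean_preserving_spread ::
    "nat \<Rightarrow> (nat \<Rightarrow> real) \<Rightarrow> (nat \<Rightarrow> real) \<Rightarrow> bool" where
  "strict_mean_preserving_spread kmax P' P \<longleftrightarrow>
     (\<Sum>k=1..kmax. real k * P k) = (\<Sum>k=1..kmax. real k * P' k) \<and>
     (\<forall>k\<in>{1..kmax}. (\<Sum>m=1..k. \<Sum>j=1..m. P j) \<le> (\<Sum>m=1..k. \<Sum>j=1..m. P' j)) \<and>
     (\<exists>k\<in>{1..kmax}. (\<Sum>m=1..k. \<Sum>j=1..m. P j) < (\<Sum>m=1..k. \<Sum>j=1..m. P' j))"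

definition hiring_policy :: "real \<Rightarrow> real \<Rightarrow> real \<Rightarrow> real \<Rightarrow> real \<Rightarrow> real \<Rightarrow> real" where
  "hiring_policy lam v y w c \<kappa> =
     (let \<psi> = 1 - lam + v * lam; \<phi> = c * (v + \<kappa> - v * \<kappa>)
      in \<psi> / (2 * \<phi>) * (y - w))"

(* Here lam is the separation probability and h the common hiring policy. *)
definition firm_unemployment_rate :: "real \<Rightarrow> real \<Rightarrow> real \<Rightarrow> nat \<Rightarrow> real" where
  "firm_unemployment_rate lam v h k = lam / (lam + h * (1 - (1 - v) ^ k))"

definition aggregate_unemployment_rate ::
    "real \<Rightarrow> real \<Rightarrow> real \<Rightarrow> nat \<Rightarrow> (nat \<Rightarrow> real) \<Rightarrow> real" where
  "aggregate_unemployment_rate lam v h kmax P =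
     (\<Sum>k=1..kmax. firm_unemployment_rate lam v h k * P k)"

end

(* Abel summation applied twice to D = P' - P turns u' - u into the sum of G k * (second difference
   of the firm-specific rate at k), where G is the iterated partial sum of D; the boundary terms
   vanish because P and P' have the same mass and the same mean.  G is nonnegative and somewhere
   positive by hypothesis, and the firm-specific rate is strictly convex in the degree. *)

theory Submission
  imports Defs
begin

text \<open>The boundary terms are kept so that the identity serves two purposes: with
  \<open>f = real\<close> it evaluates the last iterated sum, with a convex \<open>f\<close> it
  gives the comparison.\<close>

lemma sum_mult_by_parts_twice:
  fixes f D :: "nat \<Rightarrow> 'a::comm_ring_1"
  shows "(\<Sum>k=1..n. f k * D k) =
    (\<Sum>k=1..n. (\<Sum>m=1..k. \<Sum>j=1..m. D j) * (f k - 2 * f (k + 1) + f (k + 2)))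
    + (\<Sum>j=1..n. D j) * f (n + 1)
    + (\<Sum>m=1..n. \<Sum>j=1..m. D j) * (f (n + 1) - f (n + 2))"
  by (induction n) (simp_all add: algebra_simps)

lemma sum_degree_distribution:
  fixes A :: "real^'n^'n"
  assumes "\<forall>i. firm_degree A i \<in> {1..kmax}"
  shows "(\<Sum>k=1..kmax. degree_distribution A k) = 1"
proof -
  \<comment> \<open>The degree classes partition the firms, because every degree lies in the
    range.\<close>
  have "(\<Sum>k=1..kmax. card {i. firm_degree A i = k}) = CARD('n)"
    using sum.group[of UNIV "{1..kmax}" "firm_degree A" "\<lambda>_. 1::nat"] assms
    by (auto simp: image_subset_iff)
  then have "(\<Sum>k=1..kmax. real (card {i. firm_degree A i = k})) = real CARD('n)"
    by (metis of_nat_sum)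
  then show ?thesis
    by (simp add: degree_distribution_def flip: sum_divide_distrib)
qed

lemma hiring_policy_pos:
  assumes "lam \<le> 1" "0 < lam" "0 < v" "v < 1" "0 < c" "0 \<le> \<kappa>" "w < y"
  shows "0 < hiring_policy lam v y w c \<kappa>"
proof -
  have "0 < 1 - lam + v * lam"
    using assms by (simp add: add_nonneg_pos)
  \<comment> \<open>Regrouping shows a positive term plus a nonnegative one.\<close>
  moreover have "0 < c * (v + (1 - v) * \<kappa>)"
    using assms by (simp add: add_pos_nonneg)
  then have "0 < c * (v + \<kappa> - v * \<kappa>)"
    by (simp add: algebra_simps)
  ultimately show ?thesis
    using assms by (simp add: hiring_policy_def Let_def)
qed

text \<open>The denominator is positive and strictly concave in the degree, and the reciprocal of
  such a function is strictly convex.\<close>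

lemma firm_unemployment_rate_strictly_convex:
  assumes "0 < lam" "0 < h" "0 < v" "v < 1"
  shows "0 < firm_unemployment_rate lam v h k - 2 * firm_unemployment_rate lam v h (k + 1)
    + firm_unemployment_rate lam v h (k + 2)"
proof -
  define d where "d j = lam + h * (1 - (1 - v) ^ j)" for j
  have pos: "0 < d j" for j
    using assms by (simp add: d_def add_pos_nonneg power_le_one)
  \<comment> \<open>The second difference of \<open>(1 - v) ^ k\<close> is
    \<open>(1 - v) ^ k * v\<^sup>2\<close>; its positivity is the source of strictness.\<close>
  have "d k + d (k + 2) = 2 * d (k + 1) - h * (1 - v) ^ k * v\<^sup>2"
    by (simp add: d_def algebra_simps power2_eq_square)
  then have "d k + d (k + 2) < 2 * d (k + 1)"
    using assms by simp
  then have "2 / d (k + 1) < 4 / (d k + d (k + 2))"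
    using pos[of k] pos[of "k + 1"] pos[of "k + 2"] by (simp add: field_simps)
  \<comment> \<open>Harmonic against arithmetic mean: after clearing denominators it says that a
    square is nonnegative.\<close>
  also have "4 / (d k + d (k + 2)) \<le> 1 / d k + 1 / d (k + 2)"
  proof -
    have "4 * (d k * d (k + 2)) \<le> (d k + d (k + 2)) * (d k + d (k + 2))"
      using zero_le_power2[of "d k - d (k + 2)"] by (simp add: power2_eq_square algebra_simps)
    then show ?thesis
      using pos[of k] pos[of "k + 2"] by (simp add: add_frac_eq divide_simps add.commute)
  qed
  finally have "0 < lam * (1 / d k + 1 / d (k + 2) - 2 / d (k + 1))"
    using assms by simp
  then show ?thesis
    by (simp add: firm_unemployment_rate_def d_def algebra_simps)
qed

lemma strict_mean_preserving_spread_sum_less: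
  fixes f :: "nat \<Rightarrow> real"
  assumes spread: "strict_mean_preserving_spread n P' P"
    and mass: "(\<Sum>k=1..n. P k) = (\<Sum>k=1..n. P' k)"
    and convex: "\<And>k. 0 < f k - 2 * f (k + 1) + f (k + 2)"
  shows "(\<Sum>k=1..n. f k * P k) < (\<Sum>k=1..n. f k * P' k)"
proof -
  define D where "D k = P' k - P k" for k
  define G where "G k = (\<Sum>m=1..k. \<Sum>j=1..m. D j)" for k
  have G_eq: "G k = (\<Sum>m=1..k. \<Sum>j=1..m. P' j) - (\<Sum>m=1..k. \<Sum>j=1..m. P j)" for k
    by (simp add: G_def D_def sum_subtractf)
  have D_sum: "(\<Sum>j=1..n. D j) = 0"
    using mass by (simp add: D_def sum_subtractf)
  have "(\<Sum>k=1..n. real k * D k) = 0"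
    using spread
    by (simp add: strict_mean_preserving_spread_def D_def right_diff_distrib sum_subtractf)
  \<comment> \<open>For \<open>f = real\<close> the second differences vanish and
    \<open>f (n + 1) - f (n + 2)\<close> is -1, so equal masses and equal means leave only
    \<open>G n\<close>, which must be 0.\<close>
  then have G_n: "G n = 0"
    using sum_mult_by_parts_twice[of real D n] D_sum by (simp add: G_def)
  have "(\<Sum>k=1..n. f k * D k) = (\<Sum>k=1..n. G k * (f k - 2 * f (k + 1) + f (k + 2)))"
    using sum_mult_by_parts_twice[of f D n] D_sum G_n by (simp add: G_def)
  also have "\<dots> > 0"
  proof -
    have "\<forall>k\<in>{1..n}. 0 \<le> G k"
      using spread by (simp add: strict_mean_preserving_spread_def G_eq)
    moreover obtain k where "k \<in> {1..n}" "0 < G k"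
      using spread by (auto simp: strict_mean_preserving_spread_def G_eq)
    ultimately show ?thesis
      by (intro sum_pos2[of _ k] mult_nonneg_nonneg mult_pos_pos convex less_imp_le[OF convex]) auto
  qed
  finally show ?thesis
    by (simp add: D_def right_diff_distrib sum_subtractf)
qed

theorem proposition6:
  fixes A :: "real^'n^'n" and A' :: "real^'m^'m"
    and kmax :: nat
    and lam v y w c \<kappa> h :: real
    and P P' :: "nat \<Rightarrow> real"
  assumes "labor_flow_network A" and "labor_flow_network A'"
    and "\<forall>i. firm_degree A i \<in> {1..kmax}" and "\<forall>i. firm_degree A' i \<in> {1..kmax}"
    and "0 < lam" "lam \<le> 1"
    and "0 < v" "v < 1"
    and "0 < c" "c < 1"
    and "0 \<le> \<kappa>" "\<kappa> \<le> 1"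
    and "w < y"
    and "h = hiring_policy lam v y w c \<kappa>" and "h \<le> 1"
    and "P = degree_distribution A" and "P' = degree_distribution A'"
    and "strict_mean_preserving_spread kmax P' P"
  shows "aggregate_unemployment_rate lam v h kmax P
         < aggregate_unemployment_rate lam v h kmax P'"
  unfolding aggregate_unemployment_rate_def
proof (rule strict_mean_preserving_spread_sum_less)
  show "strict_mean_preserving_spread kmax P' P"
    by fact
  show "(\<Sum>k=1..kmax. P k) = (\<Sum>k=1..kmax. P' k)"
    unfolding \<open>P = degree_distribution A\<close> \<open>P' = degree_distribution A'\<close>
    using sum_degree_distribution[OF assms(3)] sum_degree_distribution[OF assms(4)] by simp
  \<comment> \<open>With \<open>h = 0\<close> the rate would be 1 at every degree; the wage lying
    below productivity rules this out.\<close>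
  have "0 < h"
    using assms by (simp add: hiring_policy_pos)
  then show "0 < firm_unemployment_rate lam v h k - 2 * firm_unemployment_rate lam v h (k + 1)
      + firm_unemployment_rate lam v h (k + 2)" for k
    using assms by (intro firm_unemployment_rate_strictly_convex)
qed

end
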